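(* Let $H^2_{\beta}$ be the weighted Hardy space of polynomial growth induced by a weight sequence $w=\{w_k\}_{k=1}^{\infty}$. If $\psi$ is an analytic function on $\overline{\mathbb{D}}$ with $\psi(\mathbb{D})\subseteq\mathbb{D}$, then the composition operator $C_{\psi}$, $C_\psi(f)=f\circ\psi$, is bounded on $H^2_{\beta}$.
   Context: $\mathbb{D}$ is the open unit disk in $\mathbb{C}$. "Analytic on $\overline{\mathbb{D}}$" means analytic on some open neighborhood of $\overline{\mathbb{D}}$. Let $w=\{w_k\}_{k\ge1}$ be positive numbers with $w_k\to1$; put $\beta_0=1$, $\beta_k=\prod_{j=1}^k w_j$. The weighted Hardy space $H^2_\beta$ induced by $w$ is the Hilbert space of functions $f(z)=\sum_{k\ge0}\widehat f(k)z^k$ analytic on $\mathbb{D}$ with $\|f\|^2=\sum_{k\ge0}|\widehat f(k)|^2\beta_k^2<\infty$. It is of polynomial growth if $\sup_k (k+1)|w_k-1|<\infty$. *)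

theory Defs
  imports "HOL-Complex_Analysis.Complex_Analysis"
begin

(* The entry w 0 plays no role here or below: weight sequences are indexed by k >= 1. *)
definition weight_sequence :: "(nat \<Rightarrow> real) \<Rightarrow> bool" where
  "weight_sequence w \<longleftrightarrow> (\<forall>k\<ge>1. w k > 0) \<and> w \<longlonglongrightarrow> 1"

definition hardy_weight :: "(nat \<Rightarrow> real) \<Rightarrow> nat \<Rightarrow> real" where
  "hardy_weight w k = (\<Prod>j = 1..k. w j)"

definition polynomial_growth :: "(nat \<Rightarrow> real) \<Rightarrow> bool" where
  "polynomial_growth w \<longleftrightarrow> bdd_above ((\<lambda>k. (real k + 1) * \<bar>w k - 1\<bar>) ` {1..})"

definition taylor_coeff :: "(complex \<Rightarrow> complex) \<Rightarrow> nat \<Rightarrow> complex" where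
  "taylor_coeff f k = fps_nth (fps_expansion f 0) k"

(* A function on the open unit disk is represented by its extension by 0 to all of the
   complex plane, so that equality of elements is equality of functions on the disk. *)
definition weighted_hardy :: "(nat \<Rightarrow> real) \<Rightarrow> (complex \<Rightarrow> complex) set" where
  "weighted_hardy w =
     {f. f analytic_on ball 0 1 \<and> (\<forall>z. z \<notin> ball 0 1 \<longrightarrow> f z = 0) \<and>
         summable (\<lambda>k. (cmod (taylor_coeff f k))\<^sup>2 * (hardy_weight w k)\<^sup>2)}"

definition weighted_hardy_norm :: "(nat \<Rightarrow> real) \<Rightarrow> (complex \<Rightarrow> complex) \<Rightarrow> real" where
  "weighted_hardy_norm w f =
     sqrt (\<Sum>k. (cmod (taylor_coeff f k))\<^sup>2 * (hardy_weight w k)\<^sup>2)"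

definition composition_operator ::
    "(complex \<Rightarrow> complex) \<Rightarrow> (complex \<Rightarrow> complex) \<Rightarrow> complex \<Rightarrow> complex" where
  "composition_operator \<psi> f = (\<lambda>z. if z \<in> ball 0 1 then f (\<psi> z) else 0)"

(* T is an everywhere defined bounded complex-linear operator from V to itself, where V is a
   space of functions with the pointwise operations and N is its norm. *)
definition bounded_operator_on ::
    "(complex \<Rightarrow> complex) set \<Rightarrow> ((complex \<Rightarrow> complex) \<Rightarrow> real) \<Rightarrow>
     ((complex \<Rightarrow> complex) \<Rightarrow> (complex \<Rightarrow> complex)) \<Rightarrow> bool" where
  "bounded_operator_on V N T \<longleftrightarrow>
     (\<forall>f\<in>V. T f \<in> V) \<and>
     (\<forall>f\<in>V. \<forall>g\<in>V. \<forall>a b. T (\<lambda>z. a * f z + b * g z) = (\<lambda>z. a * T f z + b * T g z)) \<and>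
     (\<exists>C. \<forall>f\<in>V. N (T f) \<le> C * N f)"

end

theory Submission
  imports Defs "HOL-Library.Log_Nat"
begin

text \<open>
  The operator is studied through its matrix, whose \<open>(k, n)\<close> entry is the \<open>k\<close>-th Taylor
  coefficient of \<open>\<psi>\<^sup>n\<close>. By Littlewood's subordination principle this matrix is bounded on the
  unweighted \<open>l\<^sup>2\<close>. Cauchy's estimates on one circle outside and one circle inside the unit
  circle show that its entries decay exponentially unless \<open>k\<close> and \<open>n\<close> have comparable size,
  which beats the polynomial growth of the weights. For comparable indices the
  weights are comparable, so after cutting the indices into \<open>K\<close>-adic blocks the near-diagonal part
  inherits its weighted bound, block by block, from the unweighted one.
\<close>

subsection \<open>The unweighted Hardy space\<close>

lemma taylor_coeff_eq: "taylor_coeff f k = (deriv ^^ k) f 0 / fact k"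
  by (simp add: taylor_coeff_def fps_expansion_def)

lemma taylor_coeff_power_sum:
  "taylor_coeff (\<lambda>z. \<Sum>n<N. c n * z ^ n) k = (if k < N then c k else 0)"
proof -
  have "(\<lambda>z. \<Sum>n<N. c n * z ^ n) has_fps_expansion (\<Sum>n<N. fps_const (c n) * fps_X ^ n)"
    by (intro fps_expansion_intros)
  from fps_nth_fps_expansion[OF this, of k] show ?thesis
    by (simp add: taylor_coeff_eq fps_sum_nth if_distrib[where f = "\<lambda>x. c _ * x"] sum.delta cong: if_cong)
qed

lemma taylor_coeff_sum:
  assumes "\<And>n. n \<in> A \<Longrightarrow> f n analytic_on {0}"
  shows "taylor_coeff (\<lambda>z. \<Sum>n\<in>A. c n * f n z) k = (\<Sum>n\<in>A. c n * taylor_coeff (f n) k)"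
proof -
  have "(\<lambda>z. \<Sum>n\<in>A. c n * f n z) has_fps_expansion (\<Sum>n\<in>A. fps_const (c n) * fps_expansion (f n) 0)"
    using assms by (intro fps_expansion_intros analytic_at_imp_has_fps_expansion_0)
  from fps_nth_fps_expansion[OF this, of k] show ?thesis
    by (simp add: taylor_coeff_eq fps_sum_nth fps_expansion_def)
qed

text \<open>Cauchy's formula for derivatives on the unit circle, written in the real parameter
  \<open>t\<close> so that Taylor coefficients become Fourier integrals: on this circle
  \<open>1 / e ^ k\<close> is \<open>cnj e ^ k\<close>.\<close>

lemma taylor_coeff_has_integral:
  assumes "F holomorphic_on ball 0 R" "R > 1"
  shows "((\<lambda>t. F (cis (2 * pi * t)) * cnj (cis (2 * pi * t)) ^ k) has_integral taylor_coeff F k) {0..1}"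
proof -
  have "F holomorphic_on cball 0 1"
    using assms by (intro holomorphic_on_subset[OF assms(1)]) auto
  then have "((\<lambda>u. F u / (u - 0) ^ Suc k) has_contour_integral
      (2 * pi * \<i>) / fact k * (deriv ^^ k) F 0) (circlepath 0 1)"
    by (intro Cauchy_has_contour_integral_higher_derivative_circlepath)
       (auto intro: holomorphic_on_imp_continuous_on holomorphic_on_subset)
  then have "((\<lambda>t. F (cis (2 * pi * t)) / cis (2 * pi * t) ^ Suc k * (2 * pi * \<i> * cis (2 * pi * t)))
      has_integral (2 * pi * \<i>) / fact k * (deriv ^^ k) F 0) {0..1}"
    unfolding has_contour_integral_def
  proof (rule has_integral_eq[rotated])
    fix t :: real assume "t \<in> {0..1}"
    then have "vector_derivative (circlepath 0 1) (at t within {0..1}) = 2 * pi * \<i> * cis (2 * pi * t)"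
      by (subst vector_derivative_circlepath01) (auto simp: cis_conv_exp mult_ac)
    moreover have "circlepath 0 1 t = cis (2 * pi * t)"
      by (simp add: circlepath cis_conv_exp mult_ac)
    ultimately show "F (circlepath 0 1 t) / (circlepath 0 1 t - 0) ^ Suc k *
        vector_derivative (circlepath 0 1) (at t within {0..1}) =
        F (cis (2 * pi * t)) / cis (2 * pi * t) ^ Suc k * (2 * pi * \<i> * cis (2 * pi * t))"
      by simp
  qed
  then have "((\<lambda>t. 1 / (2 * pi * \<i>) * (F (cis (2 * pi * t)) / cis (2 * pi * t) ^ Suc k * (2 * pi * \<i> * cis (2 * pi * t))))
      has_integral 1 / (2 * pi * \<i>) * ((2 * pi * \<i>) / fact k * (deriv ^^ k) F 0)) {0..1}"
    by (rule has_integral_mult_right)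
  also have "1 / (2 * pi * \<i>) * ((2 * pi * \<i>) / fact k * (deriv ^^ k) F 0) = taylor_coeff F k"
    by (simp add: taylor_coeff_eq)
  finally show ?thesis
    by (rule has_integral_eq[rotated])
       (simp add: cis_cnj flip: cis_inverse, simp add: field_simps)
qed

text \<open>Bessel's inequality in pointwise form. For the Taylor section \<open>s\<close> of length
  \<open>L\<close>, the function 2 Re (F cnj s) - |s|^2 lies below |F|^2, and its integral follows
  from finitely many coefficient integrals.\<close>

lemma bessel_minorant_has_integral:
  assumes "F holomorphic_on ball 0 R" "R > 1"
  obtains g where "\<And>t. g t \<le> (cmod (F (cis (2 * pi * t))))\<^sup>2"
    "(g has_integral (\<Sum>k<L. (cmod (taylor_coeff F k))\<^sup>2)) {0..1}"
proof
  define s where "s = (\<lambda>z. \<Sum>k<L. taylor_coeff F k * z ^ k)"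
  \<comment> \<open>Only the factor \<open>cnj s\<close> is expanded, which leaves every summand in
    the form whose integral is a Taylor coefficient.\<close>
  define g where "g = (\<lambda>t. Re (\<Sum>k<L. cnj (taylor_coeff F k) *
      (2 * (F (cis (2 * pi * t)) * cnj (cis (2 * pi * t)) ^ k) - s (cis (2 * pi * t)) * cnj (cis (2 * pi * t)) ^ k)))"
  have "s holomorphic_on ball 0 R"
    unfolding s_def by (intro holomorphic_intros)
  then have "((\<lambda>t. \<Sum>k<L. cnj (taylor_coeff F k) *
      (2 * (F (cis (2 * pi * t)) * cnj (cis (2 * pi * t)) ^ k) - s (cis (2 * pi * t)) * cnj (cis (2 * pi * t)) ^ k))
      has_integral (\<Sum>k<L. cnj (taylor_coeff F k) * (2 * taylor_coeff F k - taylor_coeff s k))) {0..1}"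
    using assms
    by (intro has_integral_sum has_integral_mult_right has_integral_diff taylor_coeff_has_integral) auto
  then have "(g has_integral Re (\<Sum>k<L. cnj (taylor_coeff F k) * (2 * taylor_coeff F k - taylor_coeff s k))) {0..1}"
    unfolding g_def by (rule has_integral_Re)
  moreover have "Re (\<Sum>k<L. cnj (taylor_coeff F k) * (2 * taylor_coeff F k - taylor_coeff s k))
      = (\<Sum>k<L. (cmod (taylor_coeff F k))\<^sup>2)"
    unfolding s_def Re_sum taylor_coeff_power_sum
    by (intro sum.cong) (auto simp: cmod_power2 algebra_simps simp flip: power2_eq_square)
  ultimately show "(g has_integral (\<Sum>k<L. (cmod (taylor_coeff F k))\<^sup>2)) {0..1}"
    by simp
  fix t
  define e where "e = cis (2 * pi * t)"
  have "cnj (s e) = (\<Sum>k<L. cnj (taylor_coeff F k) * cnj e ^ k)"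
    by (simp add: s_def)
  then have "g t = Re (2 * F e * cnj (s e) - s e * cnj (s e))"
    unfolding g_def e_def[symmetric]
    by (simp only: sum_distrib_left flip: left_diff_distrib) (simp only: sum_subtractf algebra_simps)
  \<comment> \<open>The difference of the two sides is |F e - s e|^2.\<close>
  also have "\<dots> \<le> (cmod (F e))\<^sup>2"
    using sum_power2_ge_zero[of "Re (F e) - Re (s e)" "Im (F e) - Im (s e)"]
    unfolding cmod_power2 by (simp add: power2_eq_square algebra_simps)
  finally show "g t \<le> (cmod (F (cis (2 * pi * t))))\<^sup>2"
    by (simp add: e_def)
qed

text \<open>
  With \<open>f = c\<^sub>0 + z g\<close>, the recursion \<open>h\<^sub>f = |c\<^sub>0|\<^sup>2 + 2 cnj c\<^sub>0 z g + h\<^sub>g\<close> keeps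
  \<open>Re h\<^sub>f - |f|\<^sup>2 = Re h\<^sub>g - |z|\<^sup>2 |g|\<^sup>2\<close>. The extra square in the last conjunct makes the
  induction close.
\<close>

lemma harmonic_majorant:
  fixes c :: "nat \<Rightarrow> complex"
  assumes "cmod a < 1"
  defines "K \<equiv> 2 + 4 * (cmod a)\<^sup>2 / (1 - (cmod a)\<^sup>2)"
  shows "\<exists>h. h holomorphic_on UNIV \<and> (\<forall>z. cmod z \<le> 1 \<longrightarrow> (cmod (\<Sum>n<N. c n * z ^ n))\<^sup>2 \<le> Re (h z)) \<and>
     Re (h a) + (cmod (\<Sum>n<N. c n * a ^ n))\<^sup>2 \<le> K * (\<Sum>n<N. (cmod (c n))\<^sup>2)"
proof (induction N arbitrary: c)
  case 0
  show ?case by (intro exI[of _ "\<lambda>_. 0"]) auto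
next
  case (Suc N)
  define g where "g = (\<lambda>z. \<Sum>n<N. c (Suc n) * z ^ n)"
  have f: "(\<Sum>n<Suc N. c n * z ^ n) = c 0 + z * g z" for z
    unfolding g_def sum.lessThan_Suc_shift by (simp add: sum_distrib_left mult_ac)
  obtain h where h: "h holomorphic_on UNIV" "\<And>z. cmod z \<le> 1 \<Longrightarrow> (cmod (g z))\<^sup>2 \<le> Re (h z)"
     "Re (h a) + (cmod (g a))\<^sup>2 \<le> K * (\<Sum>n<N. (cmod (c (Suc n)))\<^sup>2)"
    using Suc.IH[of "\<lambda>n. c (Suc n)"] by (auto simp: g_def)
  define h' where "h' = (\<lambda>z. c 0 * cnj (c 0) + 2 * cnj (c 0) * z * g z + h z)"
  have "h' holomorphic_on UNIV"
    unfolding h'_def g_def by (intro holomorphic_intros h)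
  moreover have h': "Re (h' z) = (cmod (c 0 + z * g z))\<^sup>2 - (cmod z)\<^sup>2 * (cmod (g z))\<^sup>2 + Re (h z)" for z
    unfolding h'_def cmod_power2 by (simp add: power2_eq_square algebra_simps)
  moreover have "(cmod (\<Sum>n<Suc N. c n * z ^ n))\<^sup>2 \<le> Re (h' z)" if "cmod z \<le> 1" for z
  proof -
    have "(cmod z)\<^sup>2 * (cmod (g z))\<^sup>2 \<le> 1 * (cmod (g z))\<^sup>2"
      using that by (intro mult_right_mono) (auto simp: power_le_one)
    with h(2)[OF that] show ?thesis by (simp add: f h' del: sum.lessThan_Suc)
  qed
  moreover have "Re (h' a) + (cmod (\<Sum>n<Suc N. c n * a ^ n))\<^sup>2 \<le> K * (\<Sum>n<Suc N. (cmod (c n))\<^sup>2)"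
  proof -
    define x r v where "x = cmod (c 0)" and "r = cmod a" and "v = cmod (g a)"
    have r: "0 < 1 - r\<^sup>2" using assms by (simp add: r_def abs_square_less_1)
    have "cmod (c 0 + a * g a) \<le> x + r * v"
      unfolding x_def r_def v_def by (metis norm_mult norm_triangle_ineq)
    then have sq: "(cmod (c 0 + a * g a))\<^sup>2 \<le> (x + r * v)\<^sup>2"
      by (intro power_mono) auto
    \<comment> \<open>Completing the square in \<open>v\<close>: 2 (x + r v)^2 - r^2 v^2 - v^2
      equals 2 x^2 + 4 r x v - (1 - r^2) v^2, which is largest at v = 2 r x / (1 - r^2). The maximum
      is K x^2, and this dictates \<open>K\<close>.\<close>
    have "0 \<le> ((1 - r\<^sup>2) * v - 2 * r * x)\<^sup>2 / (1 - r\<^sup>2)"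
      using r by simp
    also have "\<dots> = (1 - r\<^sup>2) * v\<^sup>2 - 4 * r * x * v + 4 * r\<^sup>2 * x\<^sup>2 / (1 - r\<^sup>2)"
      using r by (simp add: field_simps power2_eq_square)
    finally have "2 * (x + r * v)\<^sup>2 - r\<^sup>2 * v\<^sup>2 - v\<^sup>2 \<le> K * x\<^sup>2"
      unfolding K_def r_def[symmetric] by (simp add: power2_eq_square algebra_simps)
    with h(3) sq show ?thesis
      unfolding f h' unfolding sum.lessThan_Suc_shift x_def r_def v_def
      unfolding distrib_left by linarith
  qed
  ultimately show ?case by blast
qed

text \<open>For the polynomial with coefficients \<open>c\<close>, the squared modulus has a
  harmonic majorant \<open>Re h\<close> on the closed disc. Composed with \<open>\<psi>\<close> it
  stays harmonic, so its mean over the unit circle is its value at \<open>\<psi> 0\<close>, while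
  Bessel's inequality bounds that mean from below.\<close>

lemma littlewood_subordination:
  assumes "\<psi> holomorphic_on ball 0 R" "R > 1" and "\<And>z. cmod z \<le> 1 \<Longrightarrow> cmod (\<psi> z) \<le> 1"
    and "cmod (\<psi> 0) < 1"
  obtains C where "C \<ge> 0"
    "\<And>c N L. (\<Sum>k<L. (cmod (\<Sum>n<N. c n * taylor_coeff (\<lambda>z. \<psi> z ^ n) k))\<^sup>2) \<le> C * (\<Sum>n<N. (cmod (c n))\<^sup>2)"
proof
  define C where "C = 2 + 4 * (cmod (\<psi> 0))\<^sup>2 / (1 - (cmod (\<psi> 0))\<^sup>2)"
  have "0 < 1 - (cmod (\<psi> 0))\<^sup>2" using assms by (simp add: abs_square_less_1)
  then show "C \<ge> 0" by (simp add: C_def)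
  fix c N L
  define F where "F = (\<lambda>z. \<Sum>n<N. c n * \<psi> z ^ n)"
  have hol: "F holomorphic_on ball 0 R"
    unfolding F_def by (intro holomorphic_intros assms)
  have an: "(\<lambda>z. \<psi> z ^ n) analytic_on {0}" for n
    using assms by (intro analytic_intros) (auto simp: analytic_at intro!: exI[of _ "ball 0 R"])
  have coeff: "taylor_coeff F k = (\<Sum>n<N. c n * taylor_coeff (\<lambda>z. \<psi> z ^ n) k)" for k
    unfolding F_def by (rule taylor_coeff_sum) (rule an)
  obtain h where h: "h holomorphic_on UNIV" "\<And>z. cmod z \<le> 1 \<Longrightarrow> (cmod (\<Sum>n<N. c n * z ^ n))\<^sup>2 \<le> Re (h z)"
     "Re (h (\<psi> 0)) + (cmod (\<Sum>n<N. c n * \<psi> 0 ^ n))\<^sup>2 \<le> C * (\<Sum>n<N. (cmod (c n))\<^sup>2)"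
    using harmonic_majorant[OF assms(4), of c N] by (auto simp: C_def)
  obtain g where g: "\<And>t. g t \<le> (cmod (F (cis (2 * pi * t))))\<^sup>2"
    "(g has_integral (\<Sum>k<L. (cmod (taylor_coeff F k))\<^sup>2)) {0..1}"
    using bessel_minorant_has_integral[OF hol assms(2)] by metis
  have "(\<lambda>z. h (\<psi> z)) holomorphic_on ball 0 R"
    using holomorphic_on_compose_gen[OF assms(1) h(1)] by (auto simp: o_def)
  \<comment> \<open>The mean value property is the case \<open>k = 0\<close> of the coefficient
    integral.\<close>
  from has_integral_Re[OF taylor_coeff_has_integral[OF this assms(2), of 0]]
  have "((\<lambda>t. Re (h (\<psi> (cis (2 * pi * t))))) has_integral Re (h (\<psi> 0))) {0..1}"
    by (simp add: taylor_coeff_eq)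
  with g(2) have "(\<Sum>k<L. (cmod (taylor_coeff F k))\<^sup>2) \<le> Re (h (\<psi> 0))"
  proof (rule has_integral_le)
    fix t
    show "g t \<le> Re (h (\<psi> (cis (2 * pi * t))))"
      using g(1)[of t] h(2)[of "\<psi> (cis (2 * pi * t))"] assms(3) by (force simp: F_def)
  qed
  also have "\<dots> \<le> C * (\<Sum>n<N. (cmod (c n))\<^sup>2)"
    using h(3) zero_le_power2[of "cmod (\<Sum>n<N. c n * \<psi> 0 ^ n)"] by linarith
  finally show "(\<Sum>k<L. (cmod (\<Sum>n<N. c n * taylor_coeff (\<lambda>z. \<psi> z ^ n) k))\<^sup>2) \<le> C * (\<Sum>n<N. (cmod (c n))\<^sup>2)"
    by (simp add: coeff)
qed

subsection \<open>Weights of polynomial growth\<close>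

lemma hardy_weight_pos: "(\<And>k. k \<ge> 1 \<Longrightarrow> w k > 0) \<Longrightarrow> hardy_weight w k > 0"
  unfolding hardy_weight_def by (intro prod_pos) auto

text \<open>Bernoulli's inequality turns the bound 1 + D / (k + 1) for the weight at
  \<open>Suc k\<close> into ((k + 2) / (k + 1))^D, and the product of these quotients
  telescopes.\<close>

lemma hardy_weight_ratio_le:
  fixes D :: nat
  assumes pos: "\<And>k. k \<ge> 1 \<Longrightarrow> w k > 0"
    and D: "\<And>k. k \<ge> 1 \<Longrightarrow> (real k + 1) * \<bar>w k - 1\<bar> \<le> real D"
    and "n \<le> k"
  shows "hardy_weight w k \<le> ((real k + 1) / (real n + 1)) ^ D * hardy_weight w n"
  using \<open>n \<le> k\<close>
proof (induction k rule: dec_induct)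
  case base
  show ?case by simp
next
  case (step k)
  have "(real k + 1) * (w (Suc k) - 1) \<le> (real k + 1) * \<bar>w (Suc k) - 1\<bar>"
    by (intro mult_left_mono) auto
  also have "\<dots> \<le> (real (Suc k) + 1) * \<bar>w (Suc k) - 1\<bar>"
    by (intro mult_right_mono) auto
  also have "\<dots> \<le> D" by (rule D) simp
  finally have "w (Suc k) \<le> 1 + real D * (1 / (real k + 1))"
    by (simp add: field_simps)
  also have "\<dots> \<le> (1 + 1 / (real k + 1)) ^ D"
    by (intro Bernoulli_inequality) (simp add: field_simps)
  also have "1 + 1 / (real k + 1) = (real (Suc k) + 1) / (real k + 1)"
    by (simp add: field_simps)
  finally have w: "w (Suc k) \<le> ((real (Suc k) + 1) / (real k + 1)) ^ D" .
  have "hardy_weight w (Suc k) = hardy_weight w k * w (Suc k)"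
    by (simp add: hardy_weight_def)
  also have "\<dots> \<le> (((real k + 1) / (real n + 1)) ^ D * hardy_weight w n) * ((real (Suc k) + 1) / (real k + 1)) ^ D"
    using step.IH w pos hardy_weight_pos[of w, OF pos]
    by (intro mult_mono mult_nonneg_nonneg) (auto intro: less_imp_le)
  also have "\<dots> = ((real (Suc k) + 1) / (real n + 1)) ^ D * hardy_weight w n"
    by (simp add: power_divide)
  finally show ?case .
qed

text \<open>For \<open>n \<le> k\<close> this is the telescoping estimate. For \<open>k < n\<close>
  the same estimate is applied to the reciprocal weights, which again have polynomial growth because
  \<open>w\<close> tends to 1 and so has bounded reciprocals.\<close>

lemma hardy_weight_comparable:
  assumes "weight_sequence w" "polynomial_growth w"
  obtains M where "\<And>T k n. real k + 1 \<le> T * (real n + 1) \<Longrightarrow> real n + 1 \<le> T * (real k + 1) \<Longrightarrow>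
    hardy_weight w k \<le> T ^ M * hardy_weight w n"
proof -
  have pos: "w k > 0" if "k \<ge> 1" for k
    using assms that by (auto simp: weight_sequence_def)
  have lim: "w \<longlonglongrightarrow> 1"
    using assms by (simp add: weight_sequence_def)
  obtain D1 where D1: "(real k + 1) * \<bar>w k - 1\<bar> \<le> D1" if "k \<ge> 1" for k
    using assms(2) by (auto simp: polynomial_growth_def bdd_above_def)
  have "(\<lambda>k. inverse (w k)) \<longlonglongrightarrow> inverse 1"
    by (intro tendsto_inverse lim) simp
  then have "Bseq (\<lambda>k. inverse (w k))"
    by (intro convergent_imp_Bseq convergentI)
  then obtain B where B: "B > 0" "\<And>k. \<bar>inverse (w k)\<bar> \<le> B"
    by (auto simp: Bseq_def)
  define M where "M = nat \<lceil>max D1 (D1 * B)\<rceil>"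
  have M: "D1 \<le> M" "D1 * B \<le> M"
    unfolding M_def by linarith+
  have inv: "(real k + 1) * \<bar>inverse (w k) - 1\<bar> \<le> M" if "k \<ge> 1" for k
  proof -
    have "(real k + 1) * \<bar>inverse (w k) - 1\<bar> = ((real k + 1) * \<bar>w k - 1\<bar>) * \<bar>inverse (w k)\<bar>"
      using pos[OF that] by (simp add: abs_mult[symmetric] field_simps abs_minus_commute)
    also have "\<dots> \<le> D1 * B"
      using B D1[OF that] by (intro mult_mono) (auto intro: order.trans[OF _ D1[OF that]])
    finally show ?thesis using M by simp
  qed
  have inverse_weight: "hardy_weight (\<lambda>k. inverse (w k)) k = inverse (hardy_weight w k)" for k
    unfolding hardy_weight_def by (induction k) auto
  show thesis
  proof
    fix T k n
    assume T: "real k + 1 \<le> T * (real n + 1)" "real n + 1 \<le> T * (real k + 1)"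
    show "hardy_weight w k \<le> T ^ M * hardy_weight w n"
    proof (cases "n \<le> k")
      case True
      have "hardy_weight w k \<le> ((real k + 1) / (real n + 1)) ^ M * hardy_weight w n"
        using True D1 M pos by (intro hardy_weight_ratio_le) (auto intro: order.trans)
      also have "\<dots> \<le> T ^ M * hardy_weight w n"
        using T hardy_weight_pos[of w n, OF pos]
        by (intro mult_right_mono power_mono) (auto simp: divide_le_eq)
      finally show ?thesis .
    next
      case False
      have "inverse (hardy_weight w n) \<le> ((real n + 1) / (real k + 1)) ^ M * inverse (hardy_weight w k)"
        using False inv pos unfolding inverse_weight[symmetric]
        by (intro hardy_weight_ratio_le) auto
      also have "\<dots> \<le> T ^ M * inverse (hardy_weight w k)"
        using T hardy_weight_pos[of w k, OF pos]
        by (intro mult_right_mono power_mono) (auto simp: divide_le_eq)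
      finally show ?thesis
        using hardy_weight_pos[of w k, OF pos] hardy_weight_pos[of w n, OF pos]
        by (simp add: field_simps)
    qed
  qed
qed

subsection \<open>Off-diagonal decay\<close>

lemma taylor_coeff_cauchy_bound:
  assumes "f holomorphic_on ball 0 R" "0 < r" "r < R" "\<And>z. cmod z = r \<Longrightarrow> cmod (f z) \<le> B"
  shows "cmod (taylor_coeff f k) \<le> B / r ^ k"
proof -
  have "f holomorphic_on cball 0 r"
    using assms by (intro holomorphic_on_subset[OF assms(1)]) auto
  then have "cmod ((deriv ^^ k) f 0) \<le> fact k * B / r ^ k"
    using assms by (intro Cauchy_inequality)
      (auto intro: holomorphic_on_imp_continuous_on holomorphic_on_subset)
  then show ?thesis
    by (simp add: taylor_coeff_eq norm_divide field_simps)
qed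

text \<open>Meant for Cauchy bounds B^n / r^k with q^2 = 1 / r. Of the exponent
  \<open>2 * k\<close>, the part \<open>2 * p * n\<close> absorbs the factors \<open>B\<close>, and
  the last hypothesis leaves at least \<open>k + n\<close>.\<close>

lemma power_trade:
  fixes q :: real
  assumes "0 < q" "q \<le> 1" "0 \<le> B" "B * q ^ (2 * p) \<le> 1" "(2 * p + 1) * n \<le> k"
  shows "B ^ n * q ^ (2 * k) \<le> q ^ (k + n)"
proof -
  define d where "d = k - (2 * p + 1) * n"
  have k: "2 * k = 2 * p * n + (k + n + d)"
    using assms(5) by (simp add: d_def algebra_simps)
  have "B ^ n * q ^ (2 * k) = (B * q ^ (2 * p)) ^ n * q ^ (k + n + d)"
    unfolding k by (simp add: power_mult_distrib power_add power_mult)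
  also have "\<dots> \<le> 1 * q ^ (k + n)"
    using assms by (intro mult_mono power_le_one power_decreasing) auto
  finally show ?thesis by simp
qed

text \<open>The maximum over the compact half disc is attained, hence lies strictly below 1. This
  gap serves the inner Cauchy estimate and later the convergence of the composed Taylor
  series.\<close>

lemma self_map_bound_half_disc:
  assumes "\<psi> holomorphic_on ball 0 1" "\<psi> ` ball 0 1 \<subseteq> ball 0 1"
  obtains m where "m < 1" "\<And>z. cmod z \<le> 1/2 \<Longrightarrow> cmod (\<psi> z) \<le> m"
proof -
  have "continuous_on (cball 0 (1/2)) (\<lambda>z. cmod (\<psi> z))"
    by (intro continuous_intros holomorphic_on_imp_continuous_on holomorphic_on_subset[OF assms(1)]) auto
  then have "\<exists>x\<in>cball 0 (1/2). \<forall>y\<in>cball 0 (1/2). cmod (\<psi> y) \<le> cmod (\<psi> x)"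
    by (intro continuous_attains_sup) auto
  then obtain z0 where z0: "cmod z0 \<le> 1/2" "\<And>z. cmod z \<le> 1/2 \<Longrightarrow> cmod (\<psi> z) \<le> cmod (\<psi> z0)"
    by auto
  have "cmod (\<psi> z0) < 1"
    using assms(2) z0(1) by (force simp: image_subset_iff)
  then show thesis using z0(2) that by blast
qed

text \<open>A circle of radius \<open>r > 1\<close> gives the bound B^n / r^k, effective when
  \<open>k\<close> dominates \<open>n\<close>. The circle of radius 1/2, where the modulus of
  \<open>\<psi>\<close> is at most \<open>m < 1\<close>, gives m^n 2^k, effective when
  \<open>n\<close> dominates \<open>k\<close>.\<close>

lemma power_coeff_decay:
  assumes hol: "\<psi> holomorphic_on ball 0 R" and R: "R > 1" and img: "\<psi> ` ball 0 1 \<subseteq> ball 0 1"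
  obtains K :: nat and q :: real where "K \<ge> 2" "0 < q" "q < 1"
    "\<And>k n. K * n \<le> k \<or> K * k \<le> n \<Longrightarrow> cmod (taylor_coeff (\<lambda>z. \<psi> z ^ n) k) \<le> q ^ (k + n)"
proof -
  have coeff: "cmod (taylor_coeff (\<lambda>z. \<psi> z ^ n) k) \<le> B ^ n / r ^ k"
    if "0 < r" "r < R" "\<And>z. cmod z = r \<Longrightarrow> cmod (\<psi> z) \<le> B" for r B n k
    using that by (intro taylor_coeff_cauchy_bound[of _ R]) 
      (auto intro!: holomorphic_intros hol power_mono simp: norm_power)
  have cont: "continuous_on (cball 0 r) \<psi>" if "r < R" for r
    using that by (intro holomorphic_on_imp_continuous_on holomorphic_on_subset[OF hol]) auto

  define r where "r = (1 + R) / 2"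
  have r: "1 < r" "r < R" using R by (auto simp: r_def)
  have "bounded (\<psi> ` cball 0 r)"
    by (intro compact_imp_bounded compact_continuous_image cont r) auto
  then obtain B where B: "B > 0" "\<And>z. cmod z \<le> r \<Longrightarrow> cmod (\<psi> z) \<le> B"
    by (auto simp: bounded_pos)
  \<comment> \<open>The square root reserves half of the decay: 1 / r^k is q1^(2 k), and q1^(k + n)
    survives after \<open>B ^ n\<close> is paid for.\<close>
  define q1 where "q1 = 1 / sqrt r"
  have q1: "0 < q1" "q1 < 1" "q1 ^ 2 = 1 / r"
    using r by (auto simp: q1_def power_divide)
  obtain p1 where "B < r ^ p1"
    using real_arch_pow[OF r(1)] by blast
  then have p1: "B * q1 ^ (2 * p1) \<le> 1"
    using r by (simp add: power_mult q1 power_divide)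

  obtain m0 where "m0 < 1" and m0: "\<And>z. cmod z \<le> 1/2 \<Longrightarrow> cmod (\<psi> z) \<le> m0"
    using self_map_bound_half_disc[OF _ img] R hol by (metis holomorphic_on_subset less_imp_le subset_ball)
  \<comment> \<open>The maximum keeps \<open>m\<close> positive even when \<open>\<psi>\<close>
    vanishes identically.\<close>
  define m where "m = max (1/2) m0"
  have m: "0 < m" "m < 1" "\<And>z. cmod z \<le> 1/2 \<Longrightarrow> cmod (\<psi> z) \<le> m"
    using m0 \<open>m0 < 1\<close> by (auto simp: m_def le_max_iff_disj)
  define q2 where "q2 = sqrt m"
  have q2: "0 < q2" "q2 < 1" "q2 ^ 2 = m"
    using m by (auto simp: q2_def)
  obtain p2 where "m ^ p2 < 1/2"
    using real_arch_pow_inv[of "1/2" m] m by auto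
  then have p2: "2 * q2 ^ (2 * p2) \<le> 1"
    by (simp add: power_mult q2)

  \<comment> \<open>Large enough for both uses of \<open>power_trade\<close>, and at least 2 so that
    it can be the base of the block decomposition.\<close>
  define K where "K = 2 + (2 * p1 + 1) + (2 * p2 + 1)"
  define q where "q = max q1 q2"
  show thesis
  proof
    show "K \<ge> 2" "0 < q" "q < 1" using q1 q2 by (auto simp: K_def q_def)
    fix k n
    assume "K * n \<le> k \<or> K * k \<le> n"
    then show "cmod (taylor_coeff (\<lambda>z. \<psi> z ^ n) k) \<le> q ^ (k + n)"
    proof
      assume "K * n \<le> k"
      then have kn: "(2 * p1 + 1) * n \<le> k"
        by (rule order.trans[rotated], intro mult_le_mono1) (simp add: K_def)
      have "cmod (taylor_coeff (\<lambda>z. \<psi> z ^ n) k) \<le> B ^ n / r ^ k"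
        using r B by (intro coeff) auto
      also have "\<dots> = B ^ n * q1 ^ (2 * k)"
        by (simp add: power_mult q1 power_divide)
      also have "\<dots> \<le> q1 ^ (k + n)"
        using q1 B p1 kn by (intro power_trade) auto
      also have "\<dots> \<le> q ^ (k + n)"
        using q1 by (intro power_mono) (auto simp: q_def)
      finally show ?thesis .
    next
      assume "K * k \<le> n"
      then have kn: "(2 * p2 + 1) * k \<le> n"
        by (rule order.trans[rotated], intro mult_le_mono1) (simp add: K_def)
      have "cmod (taylor_coeff (\<lambda>z. \<psi> z ^ n) k) \<le> m ^ n / (1/2) ^ k"
        using R m by (intro coeff) auto
      also have "\<dots> = 2 ^ k * q2 ^ (2 * n)"
        by (simp add: power_mult q2 power_divide)
      \<comment> \<open>Here \<open>power_trade\<close> is used with \<open>k\<close> and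
        \<open>n\<close> exchanged and \<open>B = 2\<close>.\<close>
      also have "\<dots> \<le> q2 ^ (n + k)"
        using q2 p2 kn by (intro power_trade) auto
      also have "\<dots> \<le> q ^ (k + n)"
        unfolding add.commute[of n k] using q2 by (intro power_mono) (auto simp: q_def)
      finally show ?thesis .
    qed
  qed
qed

subsection \<open>Matrices concentrated near the diagonal\<close>

text \<open>Ratio test: the quotients of consecutive terms tend to q^2, which is below (1 + q) /
  2.\<close>

lemma summable_polynomial_geometric:
  fixes q :: real
  assumes "0 < q" "q < 1"
  shows "summable (\<lambda>k. ((real k + 1) ^ M * q ^ k)\<^sup>2)"
proof -
  define f where "f = (\<lambda>k::nat. ((real k + 1) ^ M * q ^ k)\<^sup>2)"
  define g where "g = (\<lambda>k::nat. ((1 + 1 / (real k + 1)) ^ M * q)\<^sup>2)"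
  have "(\<lambda>k. 1 / (real k + 1)) \<longlonglongrightarrow> 0"
    using LIMSEQ_inverse_real_of_nat by (simp add: inverse_eq_divide add.commute)
  then have "g \<longlonglongrightarrow> ((1 + 0) ^ M * q)\<^sup>2"
    unfolding g_def by (intro tendsto_intros)
  moreover have "((1 + 0) ^ M * q)\<^sup>2 < (1 + q) / 2"
    using assms by (simp add: power2_eq_square) (smt (verit) mult_left_le)
  ultimately have "eventually (\<lambda>k. g k < (1 + q) / 2) sequentially"
    by (rule order_tendstoD)
  then obtain N where N: "\<And>k. k \<ge> N \<Longrightarrow> g k < (1 + q) / 2"
    by (auto simp: eventually_sequentially)
  have ratio: "f (Suc k) = g k * f k" for k
  proof -
    have "1 + 1 / (real k + 1) = (real (Suc k) + 1) / (real k + 1)"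
      by (simp add: field_simps)
    then show ?thesis
      by (simp add: f_def g_def power_mult_distrib power_divide)
  qed
  have "summable f"
  proof (rule summable_ratio_test)
    show "(1 + q) / 2 < 1" using assms by simp
    fix k assume "k \<ge> N"
    then have "g k * f k \<le> (1 + q) / 2 * f k"
      using N[of k] by (intro mult_right_mono) (auto simp: f_def)
    then show "norm (f (Suc k)) \<le> (1 + q) / 2 * norm (f k)"
      by (simp add: ratio[symmetric]) (simp add: f_def)
  qed
  then show ?thesis by (simp add: f_def)
qed

text \<open>\<open>floorlog K k\<close> counts base-\<open>K\<close> digits, so block
  \<open>d \<ge> 1\<close> runs from K^(d-1) to K^d - 1 and block 0 is the index 0 alone. Writing
  \<open>Suc k\<close> lets that index fit the same bounds.\<close>

lemma floorlog_power_bounds: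
  fixes K :: nat
  assumes "K \<ge> 2"
  shows "Suc k \<le> K ^ floorlog K k" "K ^ floorlog K k \<le> K * Suc k"
proof -
  show "Suc k \<le> K ^ floorlog K k"
    using floorlog_leD[of K k "floorlog K k"] assms by simp
  show "K ^ floorlog K k \<le> K * Suc k"
  proof (cases "floorlog K k")
    case (Suc d)
    then have "K ^ d \<le> k" using floorlog_geD[of "floorlog K k" K k] by simp
    then show ?thesis unfolding Suc power_Suc by (intro mult_le_mono2) simp
  qed (use assms in simp)
qed

text \<open>\<open>K ^ j\<close> represents block \<open>j\<close>. In the second bound one factor
  \<open>K\<close> pays for the length of a block, one for the step to a neighbouring block, and one
  for the added 1.\<close>

lemma floorlog_near:
  fixes K :: nat
  assumes K: "K \<ge> 2" and j: "j \<le> floorlog K k + 1" "floorlog K k \<le> j + 1"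
  shows "Suc k \<le> K ^ 3 * Suc (K ^ j)" "Suc (K ^ j) \<le> K ^ 3 * Suc k"
proof -
  have "Suc k \<le> K ^ floorlog K k" using floorlog_power_bounds[OF K] by simp
  also have "\<dots> \<le> K ^ (3 + j)" using K j by (intro power_increasing) auto
  also have "\<dots> \<le> K ^ 3 * Suc (K ^ j)" by (simp add: power_add)
  finally show "Suc k \<le> K ^ 3 * Suc (K ^ j)" .
  have "K ^ j \<le> K ^ (floorlog K k + 1)" using K j by (intro power_increasing) auto
  also have "\<dots> \<le> K * (K * Suc k)"
    using floorlog_power_bounds(2)[OF K, of k] by simp
  finally have "K ^ j \<le> K * (K * Suc k)" .
  moreover have "1 \<le> K * (K * Suc k)" using K by simp
  ultimately have "Suc (K ^ j) \<le> 2 * (K * (K * Suc k))" by linarith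
  also have "\<dots> \<le> K * (K * (K * Suc k))" using K by (intro mult_le_mono1)
  finally show "Suc (K ^ j) \<le> K ^ 3 * Suc k" by (simp add: power3_eq_cube mult_ac)
qed

text \<open>A gap of at least two blocks puts an entry into the range of exponential decay;
  neighbouring blocks may contain indices of comparable size.\<close>

lemma floorlog_far:
  fixes K :: nat
  assumes K: "K \<ge> 2" and far: "floorlog K k + 1 < floorlog K n"
  shows "K * k \<le> n"
proof -
  have "K * k \<le> K * K ^ floorlog K k"
    using floorlog_power_bounds(1)[OF K, of k] by (intro mult_le_mono2) simp
  also have "\<dots> \<le> K ^ (floorlog K n - 1)"
    unfolding power_Suc[symmetric] using K far by (intro power_increasing) auto
  also have "\<dots> \<le> n" using far by (intro floorlog_geD) auto
  finally show ?thesis .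
qed

text \<open>The decay beats the crude comparison of weights: each weighted entry is at most
  \<open>u k * u n * \<beta> n\<close> with \<open>u\<close> square summable. The weighted matrix is
  thus dominated by one of rank one, and Cauchy-Schwarz applies.\<close>

lemma far_part_bound:
  fixes a :: "nat \<Rightarrow> nat \<Rightarrow> complex" and \<beta> :: "nat \<Rightarrow> real"
  assumes \<beta>: "\<And>k. \<beta> k > 0" "\<And>k n. \<beta> k \<le> ((real k + 1) * (real n + 1)) ^ M * \<beta> n"
    and q: "0 < q" "q < 1" and a: "\<And>k n. cmod (a k n) \<le> q ^ (k + n)"
  obtains C where "C \<ge> 0"
    "\<And>c N L. (\<Sum>k<L. (\<beta> k * cmod (\<Sum>n<N. c n * a k n))\<^sup>2) \<le> C * (\<Sum>n<N. (\<beta> n * cmod (c n))\<^sup>2)"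
proof
  define u where "u = (\<lambda>k::nat. (real k + 1) ^ M * q ^ k)"
  define U where "U = (\<Sum>k. (u k)\<^sup>2)"
  have summable: "summable (\<lambda>k. (u k)\<^sup>2)"
    unfolding u_def by (rule summable_polynomial_geometric[OF q])
  have U: "(\<Sum>k<L. (u k)\<^sup>2) \<le> U" for L
    unfolding U_def by (intro sum_le_suminf summable) auto
  have "0 \<le> U" using U[of 0] by simp
  show "U * U \<ge> 0" by simp
  have u: "u k \<ge> 0" for k using q by (simp add: u_def)
  have entry: "\<beta> k * cmod (a k n) \<le> u k * u n * \<beta> n" for k n
  proof -
    have "\<beta> k * cmod (a k n) \<le> (((real k + 1) * (real n + 1)) ^ M * \<beta> n) * q ^ (k + n)"
      using \<beta>(1)[of n] by (intro mult_mono \<beta> a) auto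
    then show ?thesis by (simp add: u_def power_mult_distrib power_add mult_ac)
  qed
  fix c N L
  define S where "S = (\<Sum>n<N. (\<beta> n * cmod (c n))\<^sup>2)"
  have "S \<ge> 0" unfolding S_def by (intro sum_nonneg) auto
  have row: "(\<beta> k * cmod (\<Sum>n<N. c n * a k n))\<^sup>2 \<le> (u k)\<^sup>2 * (U * S)" for k
  proof -
    have "\<beta> k * cmod (\<Sum>n<N. c n * a k n) \<le> \<beta> k * (\<Sum>n<N. cmod (c n) * cmod (a k n))"
      using \<beta>(1)[of k] by (intro mult_left_mono sum_norm_le) (auto simp: norm_mult)
    also have "\<dots> = (\<Sum>n<N. cmod (c n) * (\<beta> k * cmod (a k n)))"
      by (simp add: sum_distrib_left mult_ac)
    also have "\<dots> \<le> (\<Sum>n<N. cmod (c n) * (u k * u n * \<beta> n))"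
      by (intro sum_mono mult_left_mono entry) auto
    also have "\<dots> = u k * (\<Sum>n<N. u n * (\<beta> n * cmod (c n)))"
      by (simp add: sum_distrib_left mult_ac)
    finally have "(\<beta> k * cmod (\<Sum>n<N. c n * a k n))\<^sup>2 \<le> (u k * (\<Sum>n<N. u n * (\<beta> n * cmod (c n))))\<^sup>2"
      using \<beta>(1)[of k] by (intro power_mono) auto
    also have "\<dots> \<le> (u k)\<^sup>2 * ((\<Sum>n<N. (u n)\<^sup>2) * S)"
      unfolding S_def power_mult_distrib[of "u k"]
      by (intro mult_left_mono Cauchy_Schwarz_ineq_sum) auto
    also have "\<dots> \<le> (u k)\<^sup>2 * (U * S)"
      using \<open>S \<ge> 0\<close> by (intro mult_left_mono mult_right_mono U) auto
    finally show ?thesis .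
  qed
  have "(\<Sum>k<L. (\<beta> k * cmod (\<Sum>n<N. c n * a k n))\<^sup>2) \<le> (\<Sum>k<L. (u k)\<^sup>2) * (U * S)"
    unfolding sum_distrib_right by (intro sum_mono row)
  also have "\<dots> \<le> U * (U * S)"
    using \<open>S \<ge> 0\<close> \<open>U \<ge> 0\<close> by (intro mult_right_mono U) auto
  finally show "(\<Sum>k<L. (\<beta> k * cmod (\<Sum>n<N. c n * a k n))\<^sup>2) \<le> U * U * (\<Sum>n<N. (\<beta> n * cmod (c n))\<^sup>2)"
    by (simp add: S_def mult.assoc)
qed

text \<open>\<open>b n\<close> is the block of \<open>n\<close>, and \<open>\<gamma> j\<close> is
  one weight standing for all of block \<open>j\<close>. The unweighted bound is applied to each
  block of \<open>c\<close> separately, exchanging weights for \<open>\<gamma> j\<close> at the cost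
  of a factor \<open>G\<close> on either side. Each row meets at most three blocks, whence the
  factor 3.\<close>

lemma near_part_bound:
  fixes a :: "nat \<Rightarrow> nat \<Rightarrow> complex" and \<beta> \<gamma> :: "nat \<Rightarrow> real" and b :: "nat \<Rightarrow> nat"
  assumes \<beta>: "\<And>k. \<beta> k > 0" and \<gamma>: "\<And>j. \<gamma> j > 0"
    and \<beta>\<gamma>: "\<And>j k. j \<in> {b k - 1..b k + 1} \<Longrightarrow> \<beta> k \<le> G * \<gamma> j"
    and \<gamma>\<beta>: "\<And>n. \<gamma> (b n) \<le> G * \<beta> n"
    and "G \<ge> 0" "C \<ge> 0"
    and bounded: "\<And>c N L. (\<Sum>k<L. (cmod (\<Sum>n<N. c n * a k n))\<^sup>2) \<le> C * (\<Sum>n<N. (cmod (c n))\<^sup>2)"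
  shows "(\<Sum>k<L. (\<beta> k * cmod (\<Sum>n<N. c n * (if b n \<in> {b k - 1..b k + 1} then a k n else 0)))\<^sup>2)
    \<le> 3 * C * G ^ 4 * (\<Sum>n<N. (\<beta> n * cmod (c n))\<^sup>2)"
proof -
  \<comment> \<open>One finite set of blocks common to all rows, so that the sums over rows and
    blocks can be exchanged.\<close>
  define J where "J = (\<Union>k<L. {b k - 1..b k + 1})"
  have finJ: "finite J" by (simp add: J_def)
  \<comment> \<open>Only the input is cut to block \<open>j\<close>; the matrix stays whole, so
    \<open>bounded\<close> applies to it directly.\<close>
  define X where "X = (\<lambda>j k. \<Sum>n<N. (if b n = j then c n else 0) * a k n)"
  have row: "(\<beta> k * cmod (\<Sum>n<N. c n * (if b n \<in> {b k - 1..b k + 1} then a k n else 0)))\<^sup>2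
    \<le> 3 * (\<Sum>j\<in>J. (G * \<gamma> j)\<^sup>2 * (cmod (X j k))\<^sup>2)" if "k < L" for k
  proof -
    define A where "A = {b k - 1..b k + 1}"
    have A: "finite A" "card A \<le> 3" "A \<subseteq> J"
      using that by (auto simp: A_def J_def)
    have "(\<Sum>j\<in>A. X j k) = (\<Sum>n<N. \<Sum>j\<in>A. (if b n = j then c n * a k n else 0))"
      unfolding X_def by (subst sum.swap) (intro sum.cong refl, simp)
    also have "\<dots> = (\<Sum>n<N. c n * (if b n \<in> A then a k n else 0))"
      using A by (intro sum.cong refl) (auto simp: sum.delta')
    finally have "\<beta> k * cmod (\<Sum>n<N. c n * (if b n \<in> A then a k n else 0)) = \<beta> k * cmod (\<Sum>j\<in>A. X j k)"
      by simp
    also have "\<dots> \<le> \<beta> k * (\<Sum>j\<in>A. cmod (X j k))"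
      using \<beta>[of k] by (intro mult_left_mono norm_sum) auto
    also have "\<dots> \<le> (\<Sum>j\<in>A. G * \<gamma> j * cmod (X j k))"
      unfolding sum_distrib_left by (intro sum_mono mult_right_mono \<beta>\<gamma>) (auto simp: A_def)
    finally have "(\<beta> k * cmod (\<Sum>n<N. c n * (if b n \<in> A then a k n else 0)))\<^sup>2
        \<le> (\<Sum>j\<in>A. G * \<gamma> j * cmod (X j k))\<^sup>2"
      using \<beta>[of k] by (intro power_mono) auto
    also have "\<dots> \<le> (\<Sum>j\<in>A. (G * \<gamma> j * cmod (X j k))\<^sup>2) * card A"
      by (rule sum_squared_le_sum_of_squares)
    also have "\<dots> \<le> (\<Sum>j\<in>J. (G * \<gamma> j * cmod (X j k))\<^sup>2) * 3"
      using A finJ by (intro mult_mono sum_mono2 sum_nonneg) auto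
    finally show ?thesis
      by (simp add: A_def power_mult_distrib mult.commute)
  qed
  have block: "(G * \<gamma> j)\<^sup>2 * (\<Sum>k<L. (cmod (X j k))\<^sup>2) \<le>
      C * G ^ 4 * (\<Sum>n<N. if b n = j then (\<beta> n * cmod (c n))\<^sup>2 else 0)" for j
  proof -
    have "(G * \<gamma> j)\<^sup>2 * (\<Sum>k<L. (cmod (X j k))\<^sup>2)
        \<le> (G * \<gamma> j)\<^sup>2 * (C * (\<Sum>n<N. (cmod (if b n = j then c n else 0))\<^sup>2))"
      unfolding X_def by (intro mult_left_mono bounded) auto
    also have "\<dots> = C * G\<^sup>2 * (\<Sum>n<N. (\<gamma> j * cmod (if b n = j then c n else 0))\<^sup>2)"
      by (simp add: power_mult_distrib sum_distrib_left mult_ac)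
    also have "\<dots> \<le> C * G\<^sup>2 * (\<Sum>n<N. G\<^sup>2 * (if b n = j then (\<beta> n * cmod (c n))\<^sup>2 else 0))"
    proof (intro mult_left_mono sum_mono)
      fix n
      have "(\<gamma> (b n) * cmod (c n))\<^sup>2 \<le> (G * \<beta> n * cmod (c n))\<^sup>2"
        using \<gamma>[of "b n"] by (intro power_mono mult_right_mono \<gamma>\<beta>) auto
      then show "(\<gamma> j * cmod (if b n = j then c n else 0))\<^sup>2 \<le> G\<^sup>2 * (if b n = j then (\<beta> n * cmod (c n))\<^sup>2 else 0)"
        by (auto simp: power_mult_distrib mult_ac)
    qed (use \<open>C \<ge> 0\<close> in auto)
    also have "\<dots> = C * G ^ 4 * (\<Sum>n<N. if b n = j then (\<beta> n * cmod (c n))\<^sup>2 else 0)"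
      by (simp add: sum_distrib_left power2_eq_square power4_eq_xxxx mult_ac)
    finally show ?thesis .
  qed
  have "(\<Sum>k<L. (\<beta> k * cmod (\<Sum>n<N. c n * (if b n \<in> {b k - 1..b k + 1} then a k n else 0)))\<^sup>2)
      \<le> (\<Sum>k<L. 3 * (\<Sum>j\<in>J. (G * \<gamma> j)\<^sup>2 * (cmod (X j k))\<^sup>2))"
    by (intro sum_mono row) auto
  also have "\<dots> = 3 * (\<Sum>j\<in>J. (G * \<gamma> j)\<^sup>2 * (\<Sum>k<L. (cmod (X j k))\<^sup>2))"
    unfolding sum_distrib_left by (rule sum.swap)
  also have "\<dots> \<le> 3 * (\<Sum>j\<in>J. C * G ^ 4 * (\<Sum>n<N. if b n = j then (\<beta> n * cmod (c n))\<^sup>2 else 0))"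
    by (intro mult_left_mono sum_mono block) auto
  also have "\<dots> = 3 * C * G ^ 4 * (\<Sum>n<N. \<Sum>j\<in>J. if b n = j then (\<beta> n * cmod (c n))\<^sup>2 else 0)"
    by (subst sum.swap) (simp add: sum_distrib_left mult_ac)
  \<comment> \<open>Each \<open>n\<close> lies in exactly one block, so it is counted at most
    once.\<close>
  also have "\<dots> \<le> 3 * C * G ^ 4 * (\<Sum>n<N. (\<beta> n * cmod (c n))\<^sup>2)"
    using finJ \<open>C \<ge> 0\<close> \<open>G \<ge> 0\<close> by (intro mult_left_mono sum_mono) (auto simp: sum.delta')
  finally show ?thesis .
qed

text \<open>Entries whose blocks differ by at most one are handled by
  \<open>near_part_bound\<close>, all others by \<open>far_part_bound\<close>; the unweighted bound
  drives the former and the decay the latter.\<close>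

lemma weighted_matrix_bound:
  fixes a :: "nat \<Rightarrow> nat \<Rightarrow> complex" and \<beta> :: "nat \<Rightarrow> real" and K :: nat
  assumes \<beta>: "\<And>k. \<beta> k > 0"
    and growth: "\<And>T k n. real k + 1 \<le> T * (real n + 1) \<Longrightarrow> real n + 1 \<le> T * (real k + 1) \<Longrightarrow> \<beta> k \<le> T ^ M * \<beta> n"
    and bounded: "\<And>c N L. (\<Sum>k<L. (cmod (\<Sum>n<N. c n * a k n))\<^sup>2) \<le> C * (\<Sum>n<N. (cmod (c n))\<^sup>2)"
    and "C \<ge> 0" and K: "K \<ge> 2" and q: "0 < q" "q < 1"
    and decay: "\<And>k n. K * n \<le> k \<or> K * k \<le> n \<Longrightarrow> cmod (a k n) \<le> q ^ (k + n)"
  obtains D where "D \<ge> 0"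
    "\<And>c N L. (\<Sum>k<L. (\<beta> k * cmod (\<Sum>n<N. c n * a k n))\<^sup>2) \<le> D * (\<Sum>n<N. (\<beta> n * cmod (c n))\<^sup>2)"
proof -
  define b where "b = floorlog K"
  define G where "G = real (K ^ 3) ^ M"
  define near where "near = (\<lambda>k n. if b n \<in> {b k - 1..b k + 1} then a k n else 0)"
  define far where "far = (\<lambda>k n. if b n \<in> {b k - 1..b k + 1} then 0 else a k n)"
  have split: "a k n = near k n + far k n" for k n
    by (simp add: near_def far_def)
  have comparable: "\<beta> k \<le> G * \<beta> n" if "Suc k \<le> K ^ 3 * Suc n" "Suc n \<le> K ^ 3 * Suc k" for k n
  proof -
    have "real (Suc k) \<le> real (K ^ 3 * Suc n)" "real (Suc n) \<le> real (K ^ 3 * Suc k)"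
      using that by (simp_all only: of_nat_le_iff)
    then show ?thesis
      unfolding G_def by (intro growth) (simp_all add: algebra_simps)
  qed
  have near: "(\<Sum>k<L. (\<beta> k * cmod (\<Sum>n<N. c n * near k n))\<^sup>2)
      \<le> 3 * C * G ^ 4 * (\<Sum>n<N. (\<beta> n * cmod (c n))\<^sup>2)" for c N L
    unfolding near_def
  proof (rule near_part_bound[where \<gamma> = "\<lambda>j. \<beta> (K ^ j)"])
    show "\<beta> k \<le> G * \<beta> (K ^ j)" if "j \<in> {b k - 1..b k + 1}" for j k
      by (rule comparable; rule floorlog_near[OF K]) (use that in \<open>auto simp: b_def\<close>)
    show "\<beta> (K ^ b n) \<le> G * \<beta> n" for n
      by (rule comparable; rule floorlog_near[OF K]) (auto simp: b_def)
    show "G \<ge> 0" by (simp add: G_def)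
  qed (fact \<beta> bounded \<open>C \<ge> 0\<close>)+
  \<comment> \<open>Taking \<open>T\<close> to be the product of \<open>k + 1\<close> and
    \<open>n + 1\<close> always works; far from the diagonal the decay pays for the loss.\<close>
  have crude: "\<beta> k \<le> ((real k + 1) * (real n + 1)) ^ M * \<beta> n" for k n
    by (rule growth) (auto simp: algebra_simps)
  have far: "cmod (far k n) \<le> q ^ (k + n)" for k n
    using decay[of n k] floorlog_far[OF K, of n k] floorlog_far[OF K, of k n] q
    by (auto simp: far_def b_def)
  obtain E where E: "E \<ge> 0"
    "\<And>c N L. (\<Sum>k<L. (\<beta> k * cmod (\<Sum>n<N. c n * far k n))\<^sup>2) \<le> E * (\<Sum>n<N. (\<beta> n * cmod (c n))\<^sup>2)"
    using far_part_bound[OF \<beta> crude q far] by blast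
  show thesis
  proof
    show "2 * (3 * C * G ^ 4) + 2 * E \<ge> 0"
      using \<open>C \<ge> 0\<close> E(1) by (intro add_nonneg_nonneg mult_nonneg_nonneg) simp_all
    fix c N L
    have "(\<beta> k * cmod (\<Sum>n<N. c n * a k n))\<^sup>2 \<le>
        2 * (\<beta> k * cmod (\<Sum>n<N. c n * near k n))\<^sup>2 + 2 * (\<beta> k * cmod (\<Sum>n<N. c n * far k n))\<^sup>2" for k
    proof -
      define x y where "x = \<beta> k * cmod (\<Sum>n<N. c n * near k n)" and "y = \<beta> k * cmod (\<Sum>n<N. c n * far k n)"
      have "(\<Sum>n<N. c n * a k n) = (\<Sum>n<N. c n * near k n) + (\<Sum>n<N. c n * far k n)"
        by (simp add: split distrib_left sum.distrib)
      then have "\<beta> k * cmod (\<Sum>n<N. c n * a k n)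
          \<le> \<beta> k * (cmod (\<Sum>n<N. c n * near k n) + cmod (\<Sum>n<N. c n * far k n))"
        using \<beta>[of k] by (simp add: norm_triangle_ineq)
      also have "\<dots> = x + y"
        by (simp add: x_def y_def distrib_left)
      finally have "\<beta> k * cmod (\<Sum>n<N. c n * a k n) \<le> x + y" .
      then have "(\<beta> k * cmod (\<Sum>n<N. c n * a k n))\<^sup>2 \<le> (x + y)\<^sup>2"
        using \<beta>[of k] by (intro power_mono) auto
      also have "\<dots> \<le> 2 * x\<^sup>2 + 2 * y\<^sup>2"
        using zero_le_power2[of "x - y"] by (simp add: power2_eq_square algebra_simps)
      finally show ?thesis by (simp add: x_def y_def)
    qed
    then have "(\<Sum>k<L. (\<beta> k * cmod (\<Sum>n<N. c n * a k n))\<^sup>2) \<le>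
        (\<Sum>k<L. 2 * (\<beta> k * cmod (\<Sum>n<N. c n * near k n))\<^sup>2 + 2 * (\<beta> k * cmod (\<Sum>n<N. c n * far k n))\<^sup>2)"
      by (intro sum_mono)
    also have "\<dots> = 2 * (\<Sum>k<L. (\<beta> k * cmod (\<Sum>n<N. c n * near k n))\<^sup>2) + 2 * (\<Sum>k<L. (\<beta> k * cmod (\<Sum>n<N. c n * far k n))\<^sup>2)"
      by (simp add: sum.distrib sum_distrib_left)
    also have "\<dots> \<le> (2 * (3 * C * G ^ 4) + 2 * E) * (\<Sum>n<N. (\<beta> n * cmod (c n))\<^sup>2)"
      using near[of c N L] E(2)[of c N L] by (simp add: algebra_simps)
    finally show "(\<Sum>k<L. (\<beta> k * cmod (\<Sum>n<N. c n * a k n))\<^sup>2)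
      \<le> (2 * (3 * C * G ^ 4) + 2 * E) * (\<Sum>n<N. (\<beta> n * cmod (c n))\<^sup>2)" .
  qed
qed

subsection \<open>Composition operators\<close>

text \<open>This ties the operator to its matrix. \<open>\<psi>\<close> maps the half disc into a
  smaller closed disc, where the Taylor series of \<open>f\<close> converges uniformly; uniform
  limits of holomorphic functions pass to all derivatives at 0.\<close>

lemma composition_coeff_tendsto:
  assumes f: "f holomorphic_on ball 0 1" and \<psi>: "\<psi> holomorphic_on ball 0 1" "\<psi> ` ball 0 1 \<subseteq> ball 0 1"
  shows "(\<lambda>N. \<Sum>n<N. taylor_coeff f n * taylor_coeff (\<lambda>z. \<psi> z ^ n) k)
    \<longlonglongrightarrow> taylor_coeff (\<lambda>z. f (\<psi> z)) k"
proof -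
  have sums: "(\<lambda>n. taylor_coeff f n * z ^ n) sums f z" if "z \<in> ball 0 1" for z
    using holomorphic_power_series[OF f that] by (simp add: taylor_coeff_eq)
  obtain m where "m < 1" and bound: "\<And>z. cmod z \<le> 1/2 \<Longrightarrow> cmod (\<psi> z) \<le> m"
    using self_map_bound_half_disc[OF \<psi>] by blast
  have "m \<ge> 0" using bound[of 0] order.trans[OF norm_ge_zero] by auto
  \<comment> \<open>The midpoint of \<open>m\<close> and 1 is a point of the open disc beyond
    \<open>m\<close>; convergence there forces absolute convergence at \<open>m\<close>.\<close>
  with \<open>m < 1\<close> have m: "m \<ge> 0" "m < (1 + m) / 2" "(1 + m) / 2 < 1" by auto
  have "summable (\<lambda>n. norm (taylor_coeff f n * of_real m ^ n))"
    using m sums[of "of_real ((1 + m) / 2)", THEN sums_summable]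
    by (intro powser_insidea[where x = "of_real ((1 + m) / 2)"]) (auto simp del: of_real_divide of_real_add)
  then have "uniform_limit (cball 0 m) (\<lambda>N z. \<Sum>n<N. taylor_coeff f n * z ^ n)
      (\<lambda>z. \<Sum>n. taylor_coeff f n * z ^ n) sequentially"
    by (intro Weierstrass_m_test[where M = "\<lambda>n. norm (taylor_coeff f n * of_real m ^ n)"])
       (use m in \<open>auto simp: norm_mult norm_power intro!: mult_left_mono power_mono\<close>)
  then have "uniform_limit (ball 0 (1/2)) (\<lambda>N z. \<Sum>n<N. taylor_coeff f n * \<psi> z ^ n)
      (\<lambda>z. \<Sum>n. taylor_coeff f n * \<psi> z ^ n) sequentially"
    by (rule uniform_limit_compose') (use bound in auto)
  then have "(\<lambda>N. (deriv ^^ k) (\<lambda>z. \<Sum>n<N. taylor_coeff f n * \<psi> z ^ n) 0)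
      \<longlonglongrightarrow> (deriv ^^ k) (\<lambda>z. \<Sum>n. taylor_coeff f n * \<psi> z ^ n) 0"
    by (rule higher_deriv_complex_uniform_limit)
       (auto intro!: always_eventually holomorphic_intros holomorphic_on_subset[OF \<psi>(1)])
  also have "(deriv ^^ k) (\<lambda>z. \<Sum>n. taylor_coeff f n * \<psi> z ^ n) 0 = (deriv ^^ k) (\<lambda>z. f (\<psi> z)) 0"
  proof (rule higher_deriv_cong_ev)
    have "eventually (\<lambda>z. z \<in> ball 0 1) (nhds (0::complex))"
      by (intro eventually_nhds_in_open) auto
    then show "\<forall>\<^sub>F z in nhds 0. (\<Sum>n. taylor_coeff f n * \<psi> z ^ n) = f (\<psi> z)"
      by eventually_elim (use \<psi>(2) in \<open>auto intro!: sums_unique[symmetric] sums\<close>)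
  qed simp
  finally have "(\<lambda>N. taylor_coeff (\<lambda>z. \<Sum>n<N. taylor_coeff f n * \<psi> z ^ n) k)
      \<longlonglongrightarrow> taylor_coeff (\<lambda>z. f (\<psi> z)) k"
    unfolding taylor_coeff_eq[of _ k] by (intro tendsto_divide) auto
  moreover have "(\<lambda>z. \<psi> z ^ n) analytic_on {0}" for n
    using \<psi> by (intro analytic_intros) (auto simp: analytic_at intro!: exI[of _ "ball 0 1"])
  ultimately show ?thesis
    by (simp add: taylor_coeff_sum)
qed

text \<open>A point outside the closed unit ball has distance \<open>norm z - 1\<close> from
  \<open>sgn z\<close>. This turns a neighbourhood of the closed disc into a concentric disc of
  radius above 1.\<close>

lemma ball_subset_UN_ball:
  fixes e :: real
  assumes "e > 0"
  shows "ball 0 (1 + e) \<subseteq> (\<Union>z\<in>cball (0::'a::real_normed_vector) 1. ball z e)"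
proof
  fix z :: 'a
  assume "z \<in> ball 0 (1 + e)"
  then have z: "norm z < 1 + e" by simp
  have "\<exists>x\<in>cball 0 1. dist x z < e"
  proof (cases "norm z \<le> 1")
    case True
    then show ?thesis using assms by (intro bexI[of _ z]) simp_all
  next
    case False
    have "sgn z - z = (1 / norm z - 1) *\<^sub>R z"
      by (simp add: sgn_div_norm scaleR_left_diff_distrib divide_inverse)
    then have "dist (sgn z) z = \<bar>(1 / norm z - 1) * norm z\<bar>"
      by (simp only: dist_norm norm_scaleR abs_mult abs_norm_cancel)
    also have "(1 / norm z - 1) * norm z = 1 - norm z"
      using False by (auto simp: left_diff_distrib)
    finally show ?thesis
      using False z by (intro bexI[of _ "sgn z"]) (simp_all add: norm_sgn)
  qed
  then show "z \<in> (\<Union>z\<in>cball 0 1. ball z e)" by simp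
qed

theorem theorem2p2:
  fixes w :: "nat \<Rightarrow> real" and \<psi> :: "complex \<Rightarrow> complex"
  assumes "weight_sequence w"
    and "polynomial_growth w"
    and "\<psi> analytic_on cball 0 1"
    and "\<psi> ` ball 0 1 \<subseteq> ball 0 1"
  shows "bounded_operator_on (weighted_hardy w) (weighted_hardy_norm w) (composition_operator \<psi>)"
proof -
  define \<beta> where "\<beta> = hardy_weight w"
  have \<beta>: "\<beta> k > 0" for k
    using assms(1) unfolding \<beta>_def by (intro hardy_weight_pos) (auto simp: weight_sequence_def)
  obtain M where M: "\<And>T k n. real k + 1 \<le> T * (real n + 1) \<Longrightarrow> real n + 1 \<le> T * (real k + 1) \<Longrightarrow>
      \<beta> k \<le> T ^ M * \<beta> n"
    using hardy_weight_comparable[OF assms(1,2)] unfolding \<beta>_def by metis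

  obtain S where S: "open S" "cball 0 1 \<subseteq> S" "\<psi> holomorphic_on S"
    using assms(3) by (auto simp: analytic_on_holomorphic)
  obtain \<epsilon> where \<epsilon>: "\<epsilon> > 0" "(\<Union>z\<in>cball 0 1. ball z \<epsilon>) \<subseteq> S"
    using compact_subset_open_imp_ball_epsilon_subset[OF compact_cball S(1,2)] by blast
  have hol: "\<psi> holomorphic_on ball 0 (1 + \<epsilon>)"
    by (rule holomorphic_on_subset[OF S(3) order.trans[OF ball_subset_UN_ball[OF \<epsilon>(1)] \<epsilon>(2)]])
  have \<epsilon>1: "1 + \<epsilon> > 1" using \<epsilon>(1) by simp
  have hol1: "\<psi> holomorphic_on ball 0 1"
    by (rule holomorphic_on_subset[OF hol subset_ball]) (use \<epsilon>(1) in simp)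
  \<comment> \<open>The bound on the unit circle itself comes from the open disc by continuity;
    subordination integrates over that circle.\<close>
  have "continuous_on (cball 0 1) \<psi>"
    using assms(3) by (intro holomorphic_on_imp_continuous_on analytic_imp_holomorphic)
  moreover have "\<psi> ` ball 0 1 \<subseteq> cball 0 1"
    using assms(4) ball_subset_cball by (rule order.trans)
  ultimately have "\<psi> ` closure (ball 0 1) \<subseteq> cball 0 1"
    by (intro image_closure_subset) simp_all
  then have le1: "cmod (\<psi> z) \<le> 1" if "cmod z \<le> 1" for z
    using that by (simp add: image_subset_iff)
  have "cmod (\<psi> 0) < 1" using assms(4) by (force simp: image_subset_iff)

  define a where "a = (\<lambda>k n. taylor_coeff (\<lambda>z. \<psi> z ^ n) k)"
  have a: "a k n = taylor_coeff (\<lambda>z. \<psi> z ^ n) k" for k n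
    by (simp add: a_def)
  obtain C where C: "C \<ge> 0"
    "\<And>c N L. (\<Sum>k<L. (cmod (\<Sum>n<N. c n * a k n))\<^sup>2) \<le> C * (\<Sum>n<N. (cmod (c n))\<^sup>2)"
  proof (rule littlewood_subordination[OF hol \<epsilon>1 _ \<open>cmod (\<psi> 0) < 1\<close>, folded a])
    show "cmod (\<psi> z) \<le> 1" if "cmod z \<le> 1" for z using that by (rule le1)
  qed (rule that)
  obtain K q where Kq: "K \<ge> (2::nat)" "0 < q" "q < 1"
    "\<And>k n. K * n \<le> k \<or> K * k \<le> n \<Longrightarrow> cmod (a k n) \<le> q ^ (k + n)"
    by (rule power_coeff_decay[OF hol \<epsilon>1 assms(4), folded a]) (rule that)
  obtain D where D: "D \<ge> 0"
    "\<And>c N L. (\<Sum>k<L. (\<beta> k * cmod (\<Sum>n<N. c n * a k n))\<^sup>2) \<le> D * (\<Sum>n<N. (\<beta> n * cmod (c n))\<^sup>2)"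
  proof (rule weighted_matrix_bound[where \<beta> = \<beta> and a = a and M = M and C = C and K = K and q = q])
    show "\<beta> k \<le> T ^ M * \<beta> n"
      if "real k + 1 \<le> T * (real n + 1)" "real n + 1 \<le> T * (real k + 1)" for T k n
      using that by (rule M)
    show "cmod (a k n) \<le> q ^ (k + n)" if "K * n \<le> k \<or> K * k \<le> n" for k n
      using that by (rule Kq(4))
    show "(\<Sum>k<L. (cmod (\<Sum>n<N. c n * a k n))\<^sup>2) \<le> C * (\<Sum>n<N. (cmod (c n))\<^sup>2)" for c N L
      by (rule C(2))
  qed ((rule \<beta> C(1) Kq(1-3))+, rule that)

  let ?T = "composition_operator \<psi>"
  let ?term = "\<lambda>f k. (cmod (taylor_coeff f k))\<^sup>2 * (hardy_weight w k)\<^sup>2"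
  have member: "?T f \<in> weighted_hardy w \<and> weighted_hardy_norm w (?T f) \<le> sqrt D * weighted_hardy_norm w f"
    if f: "f \<in> weighted_hardy w" for f
  proof -
    have holf: "f holomorphic_on ball 0 1" and sumf: "summable (?term f)"
      using f by (auto simp: weighted_hardy_def analytic_imp_holomorphic)
    have "(\<lambda>z. f (\<psi> z)) holomorphic_on ball 0 1"
      using holomorphic_on_compose_gen[OF hol1 holf assms(4)] by (simp add: o_def)
    then have "?T f holomorphic_on ball 0 1"
      by (rule holomorphic_transform) (simp add: composition_operator_def)
    then have an: "?T f analytic_on ball 0 1"
      by (simp add: analytic_on_open)
    have "(deriv ^^ k) (?T f) 0 = (deriv ^^ k) (\<lambda>z. f (\<psi> z)) 0" for k
    proof (rule higher_deriv_cong_ev)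
      have "eventually (\<lambda>z. z \<in> ball 0 1) (nhds (0::complex))"
        by (intro eventually_nhds_in_open) auto
      then show "\<forall>\<^sub>F z in nhds 0. ?T f z = f (\<psi> z)"
        by eventually_elim (simp add: composition_operator_def)
    qed simp
    then have coeff: "(\<lambda>N. \<Sum>n<N. taylor_coeff f n * a k n) \<longlonglongrightarrow> taylor_coeff (?T f) k" for k
      using composition_coeff_tendsto[OF holf hol1 assms(4), of k]
      by (simp add: a taylor_coeff_eq)
    \<comment> \<open>For fixed \<open>L\<close> only finitely many coefficients occur, so the
      matrix bound passes to the limit in \<open>N\<close>. Its uniformity in \<open>L\<close> then
      yields both membership and the norm estimate.\<close>
    have partial: "(\<Sum>k<L. ?term (?T f) k) \<le> D * suminf (?term f)" for L
    proof (rule LIMSEQ_le_const2)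
      show "(\<lambda>N. \<Sum>k<L. (cmod (\<Sum>n<N. taylor_coeff f n * a k n))\<^sup>2 * (hardy_weight w k)\<^sup>2)
          \<longlonglongrightarrow> (\<Sum>k<L. ?term (?T f) k)"
        by (intro tendsto_intros coeff)
      have "(\<Sum>k<L. (cmod (\<Sum>n<N. taylor_coeff f n * a k n))\<^sup>2 * (hardy_weight w k)\<^sup>2) \<le> D * suminf (?term f)" for N
      proof -
        have "(\<Sum>k<L. (cmod (\<Sum>n<N. taylor_coeff f n * a k n))\<^sup>2 * (hardy_weight w k)\<^sup>2)
            \<le> D * (\<Sum>n<N. ?term f n)"
          using D(2)[of "taylor_coeff f" N L] by (simp add: \<beta>_def power_mult_distrib mult.commute)
        also have "\<dots> \<le> D * suminf (?term f)"
          using D(1) sumf by (intro mult_left_mono sum_le_suminf) auto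
        finally show ?thesis .
      qed
      then show "\<exists>N0. \<forall>N\<ge>N0. (\<Sum>k<L. (cmod (\<Sum>n<N. taylor_coeff f n * a k n))\<^sup>2 * (hardy_weight w k)\<^sup>2)
          \<le> D * suminf (?term f)"
        by blast
    qed
    have summ: "summable (?term (?T f))"
      by (rule summableI_nonneg_bounded[OF _ partial]) simp
    have "suminf (?term (?T f)) \<le> D * suminf (?term f)"
      by (rule suminf_le_const[OF summ partial])
    then have "weighted_hardy_norm w (?T f) \<le> sqrt D * weighted_hardy_norm w f"
      unfolding weighted_hardy_norm_def real_sqrt_mult[symmetric] by simp
    with an summ show ?thesis
      by (auto simp: weighted_hardy_def composition_operator_def)
  qed
  show ?thesis
    unfolding bounded_operator_on_def
  proof (intro conjI ballI allI)
    show "?T f \<in> weighted_hardy w" if "f \<in> weighted_hardy w" for f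
      using member[OF that] by blast
    show "?T (\<lambda>z. x * f z + y * g z) = (\<lambda>z. x * ?T f z + y * ?T g z)" for f g x y
      by (simp add: composition_operator_def fun_eq_iff)
    show "\<exists>C. \<forall>f\<in>weighted_hardy w. weighted_hardy_norm w (?T f) \<le> C * weighted_hardy_norm w f"
      using member by blast
  qed
qed

end
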